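(* Let $Q=(q_{ij})$ be a real symmetric $n\times n$ matrix with zero diagonal, $c\in\mathbb{R}^n$, $R_i=\{j:q_{ij}\neq0\}$. Let $\overline{GW}$ be the linear program in variables $x_i$ and $y_{ij}$ ($j\in R_i$): maximize $\sum_{i}\sum_{j\in R_i}q_{ij}y_{ij}+\sum_i c_ix_i$ subject to $x_i+x_j-y_{ij}\le1$, $y_{ij}\le x_i$, $y_{ji}\le x_i$ for all $j\in R_i$, $i=1,\dots,n$; $0\le x_i\le1$; $y_{ij}\ge0$. Let $\overline{PK}$ be the linear program with the same objective subject to $x_i+x_j-y_{ij}\le1$ and $y_{ij}+y_{ji}-2x_i\le 0$ for all $j\in R_i$, $i=1,\dots,n$; $0\le x_i\le1$; $y_{ij}\ge0$. Then the optimal objective values of $\overline{GW}$ and $\overline{PK}$ are equal.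
   Context: $\overline{GW}$ and $\overline{PK}$ are the linear programming relaxations of the Glover–Woolsey linearization GW and the linearization PK of the QUBO problem: maximize $\sum_{i}\sum_{j\in R_i}q_{ij}x_ix_j+\sum_i c_ix_i$ over $x\in\{0,1\}^n$. *)

theory Defs
  imports "HOL-Analysis.Analysis"
begin

definition supp_row :: "real^'n^'n \<Rightarrow> 'n \<Rightarrow> 'n set" where
  "supp_row Q i = {j. Q $ i $ j \<noteq> 0}"

text \<open>
  A point of either program is a pair \<open>(x, y)\<close>. The variables are the \<open>x $ i\<close> and those
  \<open>y $ i $ j\<close> with \<open>j \<in> supp_row Q i\<close>; the other entries of \<open>y\<close> are padding that occurs
  neither in the objective nor in a constraint. For symmetric \<open>Q\<close>, if \<open>y $ i $ j\<close> is a
  variable then so is \<open>y $ j $ i\<close>.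
\<close>

definition lin_objective ::
    "real^'n^'n \<Rightarrow> real^'n \<Rightarrow> (real^'n) \<times> (real^'n^'n) \<Rightarrow> real" where
  "lin_objective Q c = (\<lambda>(x, y).
     (\<Sum>i\<in>UNIV. \<Sum>j\<in>supp_row Q i. Q $ i $ j * y $ i $ j) + (\<Sum>i\<in>UNIV. c $ i * x $ i))"

definition GW_feasible :: "real^'n^'n \<Rightarrow> ((real^'n) \<times> (real^'n^'n)) set" where
  "GW_feasible Q = {(x, y).
     (\<forall>i. \<forall>j\<in>supp_row Q i.
        x $ i + x $ j - y $ i $ j \<le> 1 \<and> y $ i $ j \<le> x $ i \<and> y $ j $ i \<le> x $ i) \<and>
     (\<forall>i. 0 \<le> x $ i \<and> x $ i \<le> 1) \<and>
     (\<forall>i. \<forall>j\<in>supp_row Q i. 0 \<le> y $ i $ j)}"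

definition PK_feasible :: "real^'n^'n \<Rightarrow> ((real^'n) \<times> (real^'n^'n)) set" where
  "PK_feasible Q = {(x, y).
     (\<forall>i. \<forall>j\<in>supp_row Q i.
        x $ i + x $ j - y $ i $ j \<le> 1 \<and> y $ i $ j + y $ j $ i - 2 * x $ i \<le> 0) \<and>
     (\<forall>i. 0 \<le> x $ i \<and> x $ i \<le> 1) \<and>
     (\<forall>i. \<forall>j\<in>supp_row Q i. 0 \<le> y $ i $ j)}"

definition optimal_value :: "('a \<Rightarrow> real) \<Rightarrow> 'a set \<Rightarrow> real \<Rightarrow> bool" where
  "optimal_value f S v \<longleftrightarrow> (\<exists>z\<in>S. f z = v) \<and> (\<forall>z\<in>S. f z \<le> v)"

end

theory Submission
  imports Defs
begin

text \<open>
  Averaging \<open>y $ i $ j\<close> and \<open>y $ j $ i\<close> preserves the objective, because \<open>Q\<close> is symmetric, and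
  turns the aggregated constraint of the second program into the separate constraints of the
  first. The padding entries of \<open>y\<close> are unbounded in both programs, so the optimum is taken over
  the compact set of points of the first program all of whose entries lie in \<open>[0, 1]\<close>.
\<close>

text \<open>Off the support the coefficient vanishes. An inner index set that does not depend on
  \<open>i\<close> is what allows the order of summation to be swapped later.\<close>

lemma lin_objective_eq_full_sum:
  "lin_objective Q c (x, y) =
     (\<Sum>i\<in>UNIV. \<Sum>j\<in>UNIV. Q $ i $ j * y $ i $ j) + (\<Sum>i\<in>UNIV. c $ i * x $ i)"
proof -
  have "(\<Sum>j\<in>supp_row Q i. Q $ i $ j * y $ i $ j) = (\<Sum>j\<in>UNIV. Q $ i $ j * y $ i $ j)" for i
    by (rule sum.mono_neutral_left) (auto simp: supp_row_def)
  then show ?thesis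
    by (simp add: lin_objective_def)
qed

lemma continuous_on_lin_objective: "continuous_on S (lin_objective Q c)"
  unfolding lin_objective_def case_prod_unfold by (intro continuous_intros)

text \<open>The aggregated constraint is the sum of the two separate upper bounds by
  \<open>x $ i\<close>.\<close>

lemma GW_feasible_subset_PK_feasible: "GW_feasible Q \<subseteq> PK_feasible Q"
  by (force simp: GW_feasible_def PK_feasible_def)

definition unit_entries :: "((real^'n) \<times> (real^'n^'n)) set" where
  "unit_entries = {(x, y). (\<forall>i. 0 \<le> x $ i \<and> x $ i \<le> 1) \<and>
     (\<forall>i j. 0 \<le> y $ i $ j \<and> y $ i $ j \<le> 1)}"

lemma closed_GW_feasible: "closed (GW_feasible Q)"
  unfolding GW_feasible_def case_prod_unfold Ball_def
  \<comment> \<open>\<open>closed_Collect_imp\<close> asks for an open premise; membership in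
    \<open>supp_row Q i\<close> does not depend on the point, so it defines the whole space or the
    empty set.\<close>
  by (intro closed_Collect_conj closed_Collect_all closed_Collect_imp closed_Collect_le
      continuous_intros) auto

lemma compact_unit_entries: "compact (unit_entries :: ((real^'n) \<times> (real^'n^'n)) set)"
proof -
  have "closed (unit_entries :: ((real^'n) \<times> (real^'n^'n)) set)"
    unfolding unit_entries_def case_prod_unfold
    by (intro closed_Collect_conj closed_Collect_all closed_Collect_le continuous_intros)
  \<comment> \<open>A crude l1 estimate: \<open>x\<close> and each of the \<open>CARD('n)\<close>
    rows of \<open>y\<close> have norm at most \<open>CARD('n)\<close>.\<close>
  moreover have "norm (x, y) \<le> real CARD('n) + real CARD('n) * real CARD('n)"
    if xy: "(x, y) \<in> unit_entries" for x :: "real^'n" and y :: "real^'n^'n"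
  proof -
    have unit: "norm v \<le> real CARD('n)" if "\<forall>i. 0 \<le> v $ i \<and> v $ i \<le> 1" for v :: "real^'n"
    proof -
      have "norm v \<le> (\<Sum>i\<in>UNIV. \<bar>v $ i\<bar>)"
        by (rule norm_le_l1_cart)
      also have "\<dots> \<le> real CARD('n) * 1"
        using that by (intro sum_bounded_above) auto
      finally show ?thesis
        by simp
    qed
    have "norm y \<le> (\<Sum>i\<in>UNIV. norm (y $ i))"
      unfolding norm_vec_def by (rule L2_set_le_sum) simp
    also have "\<dots> \<le> real CARD('n) * real CARD('n)"
      using xy by (intro sum_bounded_above unit) (auto simp: unit_entries_def)
    finally have "norm y \<le> real CARD('n) * real CARD('n)" .
    moreover have "norm x \<le> real CARD('n)"
      using xy by (intro unit) (auto simp: unit_entries_def)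
    moreover have "norm (x, y) \<le> norm x + norm y"
      by (rule norm_Pair_le)
    ultimately show ?thesis
      by linarith
  qed
  then have "bounded (unit_entries :: ((real^'n) \<times> (real^'n^'n)) set)"
    unfolding bounded_iff by (metis surj_pair)
  ultimately show ?thesis
    by (simp add: compact_eq_bounded_closed)
qed

lemma PK_feasible_symmetrize:
  fixes Q :: "real^'n^'n"
  assumes "transpose Q = Q" and "z \<in> PK_feasible Q"
  obtains z' where "z' \<in> GW_feasible Q \<inter> unit_entries"
    and "lin_objective Q c z' = lin_objective Q c z"
proof -
  obtain x y where z: "z = (x, y)"
    by (cases z)
  have sym: "Q $ i $ j = Q $ j $ i" for i j
    using assms(1) by (metis transpose_def vec_lambda_beta)
  \<comment> \<open>Padding is reset to 0, since its values in \<open>y\<close> are arbitrary and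
    could leave \<open>unit_entries\<close>.\<close>
  define y' :: "real^'n^'n"
    where "y' = (\<chi> i j. if Q $ i $ j = 0 then 0 else (y $ i $ j + y $ j $ i) / 2)"
  have x: "0 \<le> x $ i" "x $ i \<le> 1" for i
    using assms(2) by (auto simp: PK_feasible_def z)
  have y: "x $ i + x $ j - y $ i $ j \<le> 1" "y $ i $ j + y $ j $ i \<le> 2 * x $ i" "0 \<le> y $ i $ j"
    if "Q $ i $ j \<noteq> 0" for i j
    using assms(2) that by (auto simp: PK_feasible_def supp_row_def z)
  \<comment> \<open>The lower bound averages the constraints for \<open>(i, j)\<close> and
    \<open>(j, i)\<close>; the upper bounds are half the aggregated constraint, as \<open>y'\<close>
    is symmetric.\<close>
  have y': "x $ i + x $ j - y' $ i $ j \<le> 1" "y' $ i $ j \<le> x $ i" "y' $ j $ i \<le> x $ i"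
    "0 \<le> y' $ i $ j" if "Q $ i $ j \<noteq> 0" for i j
    using that y[of i j] y[of j i] sym[of i j] by (auto simp: y'_def field_simps)
  have "0 \<le> y' $ i $ j \<and> y' $ i $ j \<le> 1" for i j
  proof (cases "Q $ i $ j = 0")
    case True
    then show ?thesis
      by (simp add: y'_def)
  next
    case False
    then show ?thesis
      using y'[of i j] x[of i] by linarith
  qed
  then have "(x, y') \<in> GW_feasible Q \<inter> unit_entries"
    using x y' by (auto simp: GW_feasible_def unit_entries_def supp_row_def)
  moreover have "lin_objective Q c (x, y') = lin_objective Q c z"
  proof -
    \<comment> \<open>Up to renaming of indices, the right-hand side is the original quadratic part,
      so both halves of the average contribute equally.\<close>
    have "(\<Sum>i\<in>UNIV. \<Sum>j\<in>UNIV. Q $ i $ j * y $ j $ i) =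
        (\<Sum>j\<in>UNIV. \<Sum>i\<in>UNIV. Q $ j $ i * y $ j $ i)"
      by (subst sum.swap) (simp add: sym)
    moreover have "Q $ i $ j * y' $ i $ j = (Q $ i $ j * y $ i $ j + Q $ i $ j * y $ j $ i) / 2"
      for i j
      by (simp add: y'_def distrib_left)
    then have "(\<Sum>i\<in>UNIV. \<Sum>j\<in>UNIV. Q $ i $ j * y' $ i $ j) =
        ((\<Sum>i\<in>UNIV. \<Sum>j\<in>UNIV. Q $ i $ j * y $ i $ j) +
         (\<Sum>i\<in>UNIV. \<Sum>j\<in>UNIV. Q $ i $ j * y $ j $ i)) / 2"
      by (simp only: sum.distrib flip: sum_divide_distrib)
    ultimately show ?thesis
      by (simp add: lin_objective_eq_full_sum z)
  qed
  ultimately show thesis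
    by (rule that)
qed

theorem theorem23:
  fixes Q :: "real^'n^'n" and c :: "real^'n"
  assumes "transpose Q = Q"
    and "\<And>i. Q $ i $ i = 0"
  shows "\<exists>v. optimal_value (lin_objective Q c) (GW_feasible Q) v \<and>
             optimal_value (lin_objective Q c) (PK_feasible Q) v"
proof -
  let ?f = "lin_objective Q c" and ?K = "GW_feasible Q \<inter> unit_entries"
  have "compact ?K"
    by (intro closed_Int_compact closed_GW_feasible compact_unit_entries)
  moreover have "(0, 0) \<in> ?K"
    by (auto simp: GW_feasible_def unit_entries_def)
  ultimately obtain z where z: "z \<in> ?K" and max: "\<And>w. w \<in> ?K \<Longrightarrow> ?f w \<le> ?f z"
    using continuous_attains_sup[OF _ _ continuous_on_lin_objective, of ?K Q c] by blast
  \<comment> \<open>The symmetrized \<open>w\<close> lies in \<open>?K\<close> with the same value.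
    By the inclusion of the feasible sets, this one bound makes \<open>z\<close> optimal for both
    programs.\<close>
  have "?f w \<le> ?f z" if "w \<in> PK_feasible Q" for w
    using PK_feasible_symmetrize[OF assms(1) that] max by metis
  with z GW_feasible_subset_PK_feasible[of Q] show ?thesis
    unfolding optimal_value_def by (intro exI[of _ "?f z"]) blast
qed

end
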